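(* Let $p\in(0,1)$ and $S=\{s_i\}$, $i\in\{1,2,\dots,N\}$, $s_i\in\mathbb{R}$, be given, and let $\alpha=\sqrt{\frac{p}{1-p}}$. Consider the likelihood $\mathcal{L}(\mu,\lambda)=\prod_{i=1}^N\psi(s_i;\mu,\lambda,p)$ of the asymmetric Laplace distribution as a function of $(\mu,\lambda)$, with $p$ fixed. Then the likelihood has an optimum (maximum) where the partition $\mu^*$ is given by the weighted median, with samples in $S_-$ and $S_+$ weighted by $\alpha^{-1}$ and $\alpha$, respectively, and $$\lambda^*=\frac{|S|}{\alpha\sum_{s_i\in S_+}(s_i-\mu^* )-\alpha^{-1}\sum_{s_i\in S_-}(s_i-\mu^* )},$$ where $S_-=\{s_i\in S\mid s_i<\mu^*\}$ and $S_+=\{s_i\in S\mid s_i>\mu^*\}$. Furthermore, let $\mu^*_1$ and $\mu^*_2$, $\mu^*_1<\mu^*_2$, be optimal partitions. Then there is no $s_i\in S$ such that $\mu^*_1<s_i<\mu^*_2$, that is, all optimal partitions induce the same sets $S_-$ and $S_+$.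
   Context: For $p\in(0,1)$, $\lambda\in(0,\infty)$, $\mu\in\mathbb{R}$, with $\alpha=\sqrt{\frac{p}{1-p}}$ and $\beta=\frac{\lambda\alpha}{\alpha^2+1}$, the asymmetric Laplace density is $$\psi(x;\mu,\lambda,p)=\begin{cases}\beta\exp(-\lambda\alpha(x-\mu)), & x\ge\mu,\\ \beta\exp(\lambda\alpha^{-1}(x-\mu)), & x<\mu.\end{cases}$$ An optimal partition is a value of $\mu$ that is the $\mu$-component of an optimum of the likelihood. Samples are counted with multiplicity and $|S|=N$. The weights depend on the side of $\mu^*$ on which a sample lies: "$\mu^*$ is the weighted median with left weight $\alpha^{-1}$ and right weight $\alpha$" means that $$\alpha^{-1}\,\#\{i: s_i<\mu^*\}\le\alpha\,\#\{i: s_i\ge\mu^*\}\quad\text{and}\quad \alpha\,\#\{i: s_i>\mu^*\}\le\alpha^{-1}\,\#\{i: s_i\le\mu^*\}.$$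
   Formalization: The optimum claim assumes the samples are not all equal (otherwise the likelihood is unbounded or λ* is 0/0); "the same sets S_- and S_+" is corrected to: equal up to samples lying exactly on μ*_1 (for S_-) or on μ*_2 (for S_+), since literal equality fails for p=1/2 and samples 0, 1. *)

theory Defs
  imports Complex_Main
begin

definition alpha :: "real \<Rightarrow> real" where
  "alpha p = sqrt (p / (1 - p))"

definition beta :: "real \<Rightarrow> real \<Rightarrow> real" where
  "beta p l = l * alpha p / ((alpha p)\<^sup>2 + 1)"

definition al_density :: "real \<Rightarrow> real \<Rightarrow> real \<Rightarrow> real \<Rightarrow> real" where
  "al_density p m l x =
     (if x \<ge> m then beta p l * exp (- l * alpha p * (x - m))
      else beta p l * exp (l * inverse (alpha p) * (x - m)))"

text \<open>A sample of size \<open>N\<close> is a family \<open>s i\<close> indexed by \<open>i \<in> {1..N}\<close>, so repeated values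
  are counted with multiplicity; values of \<open>s\<close> outside this range are irrelevant.\<close>

definition likelihood :: "real \<Rightarrow> nat \<Rightarrow> (nat \<Rightarrow> real) \<Rightarrow> real \<Rightarrow> real \<Rightarrow> real" where
  "likelihood p N s m l = (\<Prod>i=1..N. al_density p m l (s i))"

definition is_optimum :: "real \<Rightarrow> nat \<Rightarrow> (nat \<Rightarrow> real) \<Rightarrow> real \<Rightarrow> real \<Rightarrow> bool" where
  "is_optimum p N s m l \<longleftrightarrow>
     is_arg_max (\<lambda>(m, l). likelihood p N s m l) (\<lambda>(m, l). l > 0) (m, l)"

definition optimal_partition :: "real \<Rightarrow> nat \<Rightarrow> (nat \<Rightarrow> real) \<Rightarrow> real \<Rightarrow> bool" where
  "optimal_partition p N s m \<longleftrightarrow> (\<exists>l. is_optimum p N s m l)"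

text \<open>The sets \<open>S\<^sub>-\<close> and \<open>S\<^sub>+\<close> are represented by their index sets, which keeps multiplicities.
  Both inequalities are strict: a sample equal to \<open>m\<close> belongs to neither set.\<close>

definition S_minus :: "nat \<Rightarrow> (nat \<Rightarrow> real) \<Rightarrow> real \<Rightarrow> nat set" where
  "S_minus N s m = {i \<in> {1..N}. s i < m}"

definition S_plus :: "nat \<Rightarrow> (nat \<Rightarrow> real) \<Rightarrow> real \<Rightarrow> nat set" where
  "S_plus N s m = {i \<in> {1..N}. s i > m}"

text \<open>Left weight \<open>wl\<close>, right weight \<open>wr\<close>. The weight of a sample depends on the side of \<open>m\<close> it
  lies on, so this is not the usual median of a sample with preassigned weights. In general the
  weighted median is not unique.\<close>

definition is_weighted_median ::
    "real \<Rightarrow> real \<Rightarrow> nat \<Rightarrow> (nat \<Rightarrow> real) \<Rightarrow> real \<Rightarrow> bool" where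
  "is_weighted_median wl wr N s m \<longleftrightarrow>
     wl * real (card {i \<in> {1..N}. s i < m}) \<le> wr * real (card {i \<in> {1..N}. s i \<ge> m}) \<and>
     wr * real (card {i \<in> {1..N}. s i > m}) \<le> wl * real (card {i \<in> {1..N}. s i \<le> m})"

definition lambda_star :: "real \<Rightarrow> nat \<Rightarrow> (nat \<Rightarrow> real) \<Rightarrow> real \<Rightarrow> real" where
  "lambda_star p N s m =
     real N / (alpha p * (\<Sum>i\<in>S_plus N s m. s i - m)
               - inverse (alpha p) * (\<Sum>i\<in>S_minus N s m. s i - m))"

end

theory Submission
  imports Defs
begin

text \<open>
  The likelihood factors as \<open>(l k)\<^sup>N exp (- l R m)\<close>, where \<open>k\<close> depends only on \<open>p\<close> and
  \<open>R m\<close> is the sum of the pinball losses of the \<open>s i - m\<close>. Hence, whatever \<open>l > 0\<close>, the best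
  \<open>m\<close> are exactly the minimizers of the convex, piecewise linear function \<open>R\<close>. The median
  inequalities say that the one-sided slopes of \<open>R\<close> have the right signs, and \<open>l = N / R m\<close>
  then comes from \<open>x exp (- x) \<le> exp (- 1)\<close>. As \<open>R\<close> has a strict kink at every sample, no
  sample lies strictly between two minimizers.
\<close>

section \<open>Pinball loss, risk, and the kinks of the risk at the samples\<close>

definition pinball :: "real \<Rightarrow> real \<Rightarrow> real \<Rightarrow> real" where
  "pinball a b t = max (a * t) (- (b * t))"

definition risk :: "real \<Rightarrow> real \<Rightarrow> nat \<Rightarrow> (nat \<Rightarrow> real) \<Rightarrow> real \<Rightarrow> real" where
  "risk a b N s m = (\<Sum>i=1..N. pinball a b (s i - m))"

lemma pinball_0 [simp]: "pinball a b 0 = 0"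
  by (simp add: pinball_def)

lemma pinball_pos:
  assumes "0 < a" "0 < b" "t \<noteq> 0"
  shows "0 < pinball a b t"
  using assms by (cases "t > 0") (auto simp: pinball_def less_max_iff_disj mult_less_0_iff)

lemma pinball_of_nonneg: "0 \<le> a \<Longrightarrow> 0 \<le> b \<Longrightarrow> 0 \<le> t \<Longrightarrow> pinball a b t = a * t"
  unfolding pinball_def by (rule max_absorb1) (meson mult_nonneg_nonneg neg_le_0_iff_le order_trans)

lemma pinball_of_nonpos:
  assumes "0 \<le> a" "0 \<le> b" "t \<le> 0"
  shows "pinball a b t = - (b * t)"
  using mult_nonneg_nonpos[OF assms(1,3)] mult_nonneg_nonpos[OF assms(2,3)]
  by (simp add: pinball_def)

lemma pinball_nonneg:
  assumes "0 \<le> a" "0 \<le> b"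
  shows "0 \<le> pinball a b t"
  using assms by (cases "0 \<le> t") (auto simp: pinball_of_nonneg pinball_of_nonpos mult_nonneg_nonpos)

lemma pinball_add_le: "pinball a b (t + u) \<le> pinball a b t + pinball a b u"
  unfolding pinball_def by (auto simp: algebra_simps)

lemma pinball_scale: "0 \<le> c \<Longrightarrow> pinball a b (c * t) = c * pinball a b t"
  unfolding pinball_def by (simp add: max_mult_distrib_left mult.left_commute)

text \<open>Subadditivity and positive homogeneity of the loss give convexity. Scaling by
  \<open>m2 - m1\<close> avoids a division and keeps the case \<open>m1 = m2\<close> valid.\<close>

lemma pinball_convex:
  assumes "m1 \<le> m" "m \<le> m2"
  shows "(m2 - m1) * pinball a b (x - m)
         \<le> (m2 - m) * pinball a b (x - m1) + (m - m1) * pinball a b (x - m2)"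
proof -
  have "(m2 - m1) * pinball a b (x - m) = pinball a b ((m2 - m1) * (x - m))"
    using assms by (simp add: pinball_scale)
  also have "(m2 - m1) * (x - m) = (m2 - m) * (x - m1) + (m - m1) * (x - m2)"
    by (simp add: algebra_simps)
  also have "pinball a b \<dots> \<le> pinball a b ((m2 - m) * (x - m1)) + pinball a b ((m - m1) * (x - m2))"
    by (rule pinball_add_le)
  finally show ?thesis
    using assms by (simp add: pinball_scale)
qed

text \<open>Two distinct samples cannot both equal \<open>m\<close>, so some summand is positive.
  This makes \<open>N / risk\<close> a genuine positive candidate for \<open>l\<close>.\<close>

lemma risk_pos:
  assumes "0 < a" "0 < b" "i \<in> {1..N}" "j \<in> {1..N}" "s i \<noteq> s j"
  shows "0 < risk a b N s m"
proof -
  obtain k where "k \<in> {1..N}" "s k \<noteq> m"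
    using assms by metis
  then show ?thesis
    unfolding risk_def using assms
    by (intro sum_pos2[of _ k]) (auto intro: pinball_pos pinball_nonneg)
qed

lemma no_sample_between_minimizers:
  assumes ab: "0 < a" "0 < b"
    and min1: "\<And>m. risk a b N s m1 \<le> risk a b N s m"
    and min2: "\<And>m. risk a b N s m2 \<le> risk a b N s m"
    and i: "i \<in> {1..N}" "m1 < s i" "s i < m2"
  shows False
proof -
  let ?R = "risk a b N s" and ?m = "s i"
  have "(m2 - m1) * ?R ?m < (\<Sum>j=1..N. (m2 - ?m) * pinball a b (s j - m1) + (?m - m1) * pinball a b (s j - m2))"
    unfolding risk_def sum_distrib_left
  proof (rule sum_strict_mono_ex1)
    show "\<forall>j\<in>{1..N}. (m2 - m1) * pinball a b (s j - ?m)
        \<le> (m2 - ?m) * pinball a b (s j - m1) + (?m - m1) * pinball a b (s j - m2)"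
      using i by (auto intro: pinball_convex)
    \<comment> \<open>For \<open>j = i\<close> the left side vanishes while both losses on the right
      are positive: this is the kink at \<open>s i\<close>.\<close>
    show "\<exists>j\<in>{1..N}. (m2 - m1) * pinball a b (s j - ?m)
        < (m2 - ?m) * pinball a b (s j - m1) + (?m - m1) * pinball a b (s j - m2)"
      using i ab by (intro bexI[of _ i]) (auto intro!: add_pos_pos mult_pos_pos pinball_pos)
  qed simp
  also have "\<dots> = (m2 - ?m) * ?R m1 + (?m - m1) * ?R m2"
    by (simp add: risk_def sum.distrib sum_distrib_left)
  \<comment> \<open>Both minimal values are at most the risk at \<open>s i\<close>, and the weights
    add up to \<open>m2 - m1\<close>, which closes a strict cycle.\<close>
  also have "\<dots> \<le> (m2 - ?m) * ?R ?m + (?m - m1) * ?R ?m"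
    using i min1 min2 by (intro add_mono mult_left_mono) auto
  also have "\<dots> = (m2 - m1) * ?R ?m"
    by (simp add: algebra_simps)
  finally show False by simp
qed

section \<open>Weighted medians: minimality for the risk and existence\<close>

lemma sum_two_valued:
  fixes u v :: real and N :: nat
  shows "(\<Sum>i=1..N. if P i then u else v)
         = u * real (card {i \<in> {1..N}. P i}) + v * real (card {i \<in> {1..N}. \<not> P i})"
proof -
  have "{1..N} \<inter> {i. Q i} = {i \<in> {1..N}. Q i}" for Q by blast
  then show ?thesis by (simp only: sum.If_cases finite_atLeastAtMost Collect_neg_eq[symmetric])
      (simp add: mult.commute)
qed

text \<open>A convex function lies above its one-sided tangents, and the median inequalities fix the
  signs of their slopes at \<open>m\<close>. The left weight is \<open>b\<close> because
  \<open>b\<close> is the rate of the loss for samples left of \<open>m\<close>.\<close>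

lemma weighted_median_minimizes_risk:
  assumes ab: "0 \<le> a" "0 \<le> b" and med: "is_weighted_median b a N s m"
  shows "risk a b N s m \<le> risk a b N s m'"
proof (cases "m \<le> m'")
  case True
  define d where "d = m' - m"
  \<comment> \<open>The factor after \<open>d\<close> is the right derivative of the risk at
    \<open>m\<close>: samples up to \<open>m\<close> contribute \<open>b\<close>, the others
    \<open>- a\<close>.\<close>
  have "0 \<le> d * (b * real (card {i \<in> {1..N}. s i \<le> m}) - a * real (card {i \<in> {1..N}. s i > m}))"
    using True med by (simp add: d_def is_weighted_median_def)
  also have "\<dots> = (\<Sum>i=1..N. if s i \<le> m then d * b else - (d * a))"
    unfolding sum_two_valued by (simp add: right_diff_distrib not_le)
  also have "\<dots> \<le> (\<Sum>i=1..N. pinball a b (s i - m') - pinball a b (s i - m))"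
  proof (rule sum_mono)
    fix i
    \<comment> \<open>Equality holds if \<open>s i \<le> m\<close>. Otherwise the loss at
      \<open>m\<close> is on its linear piece of slope \<open>a\<close>, which bounds the loss at
      \<open>m'\<close> from below.\<close>
    show "(if s i \<le> m then d * b else - (d * a)) \<le> pinball a b (s i - m') - pinball a b (s i - m)"
      using True ab max.cobounded1[of "a * (s i - m')" "- (b * (s i - m'))"]
      by (auto simp: d_def pinball_of_nonneg pinball_of_nonpos algebra_simps)
         (simp add: pinball_def algebra_simps)
  qed
  finally show ?thesis by (simp add: risk_def sum_subtractf)
next
  case False
  define d where "d = m - m'"
  \<comment> \<open>Mirror image: the factor is minus the left derivative, so samples equal to
    \<open>m\<close> now count on the right.\<close>
  have "0 \<le> d * (a * real (card {i \<in> {1..N}. s i \<ge> m}) - b * real (card {i \<in> {1..N}. s i < m}))"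
    using False med by (simp add: d_def is_weighted_median_def)
  also have "\<dots> = (\<Sum>i=1..N. if s i \<ge> m then d * a else - (d * b))"
    unfolding sum_two_valued by (simp add: right_diff_distrib not_le)
  also have "\<dots> \<le> (\<Sum>i=1..N. pinball a b (s i - m') - pinball a b (s i - m))"
  proof (rule sum_mono)
    fix i
    show "(if s i \<ge> m then d * a else - (d * b)) \<le> pinball a b (s i - m') - pinball a b (s i - m)"
      using False ab max.cobounded2[of "- (b * (s i - m'))" "a * (s i - m')"]
      by (auto simp: d_def pinball_of_nonneg pinball_of_nonpos algebra_simps)
         (simp add: pinball_def algebra_simps)
  qed
  finally show ?thesis by (simp add: risk_def sum_subtractf)
qed

text \<open>As for an ordinary quantile, the smallest sample whose cumulative count reaches the
  threshold works.\<close>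

lemma weighted_median_exists:
  assumes w: "0 \<le> wl" "0 \<le> wr"
  shows "\<exists>m. is_weighted_median wl wr N s m"
proof (cases "N = 0")
  case True
  then show ?thesis by (simp add: is_weighted_median_def)
next
  case False
  define A where "A m = card {i \<in> {1..N}. s i < m}" for m
  define B where "B m = card {i \<in> {1..N}. s i \<le> m}" for m
  have split: "card {i \<in> {1..N}. P i} + card {i \<in> {1..N}. \<not> P i} = N" for P
    using card_Int_Diff[of "{1..N}" "Collect P"]
    by (simp add: Int_def set_diff_eq)
  have ge: "real (card {i \<in> {1..N}. s i \<ge> m}) = real N - A m" for m
    using split[of "\<lambda>i. s i < m"] by (simp add: A_def not_less)
  have gt: "real (card {i \<in> {1..N}. s i > m}) = real N - B m" for m
    using split[of "\<lambda>i. s i \<le> m"] by (simp add: B_def not_le)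
  have median_iff: "is_weighted_median wl wr N s m
      \<longleftrightarrow> (wl + wr) * A m \<le> wr * N \<and> wr * N \<le> (wl + wr) * B m" for m
    unfolding is_weighted_median_def ge gt A_def[symmetric] B_def[symmetric]
    by (auto simp: algebra_simps)
  define Q where "Q = {x \<in> s ` {1..N}. wr * N \<le> (wl + wr) * B x}"
  have finQ: "finite Q" by (simp add: Q_def)
  \<comment> \<open>The largest sample has cumulative count \<open>N\<close>, so \<open>Q\<close> is
    nonempty.\<close>
  have "{i \<in> {1..N}. s i \<le> Max (s ` {1..N})} = {1..N}" by auto
  then have "B (Max (s ` {1..N})) = N" by (simp add: B_def)
  moreover have "Max (s ` {1..N}) \<in> s ` {1..N}" using False by (intro Max_in) auto
  ultimately have "Max (s ` {1..N}) \<in> Q" using w by (auto simp: Q_def algebra_simps)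
  then have MinQ: "Min Q \<in> Q" using finQ by (intro Min_in) auto
  have "(wl + wr) * A (Min Q) \<le> wr * N"
  proof (cases "A (Min Q) = 0")
    case True
    then show ?thesis using w by simp
  next
    case nonzero: False
    \<comment> \<open>No sample lies strictly between \<open>Max T\<close> and \<open>Min Q\<close>,
      so the count up to \<open>Max T\<close> is the count below \<open>Min Q\<close>; by minimality
      of \<open>Min Q\<close> it misses the threshold.\<close>
    define T where "T = {x \<in> s ` {1..N}. x < Min Q}"
    have "T \<noteq> {}" using nonzero by (auto simp: T_def A_def)
    then have MaxT: "Max T \<in> T" by (intro Max_in) (auto simp: T_def)
    then have "{i \<in> {1..N}. s i \<le> Max T} = {i \<in> {1..N}. s i < Min Q}"
      by (auto simp: T_def intro!: Max_ge)
    then have "B (Max T) = A (Min Q)" by (simp add: A_def B_def)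
    moreover have "Max T \<notin> Q"
      using MaxT Min_le[OF finQ, of "Max T"] by (auto simp: T_def)
    ultimately show ?thesis using MaxT by (auto simp: T_def Q_def)
  qed
  then show ?thesis using MinQ by (auto simp: median_iff Q_def)
qed

section \<open>Maximization in \<open>l\<close>\<close>

lemma mult_exp_minus_le: "x * exp (- x) \<le> exp (- 1)" for x :: real
proof -
  have "x \<le> exp (x - 1)" using exp_ge_add_one_self[of "x - 1"] by simp
  then have "x * exp (- x) \<le> exp (x - 1) * exp (- x)" by (intro mult_right_mono) auto
  then show ?thesis by (simp add: exp_add[symmetric])
qed

text \<open>The right side is the left side at \<open>l = N / r\<close>. The bound is the previous
  one at \<open>x = l * r / N\<close>, raised to the power \<open>N\<close>.\<close>

lemma power_mult_exp_le_at_ratio: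
  fixes l r :: real
  assumes "0 \<le> l" "0 < r" "0 < N"
  shows "l ^ N * exp (- (l * r)) \<le> (N / r) ^ N * exp (- real N)"
proof -
  have "l * r / N * exp (- (l * r / N)) \<le> exp (- 1)" by (rule mult_exp_minus_le)
  then have "(l * exp (- (l * r / N))) \<le> N / r * exp (- 1)"
    using assms by (simp add: field_simps)
  then have "(l * exp (- (l * r / N))) ^ N \<le> (N / r * exp (- 1)) ^ N"
    using assms by (intro power_mono) auto
  then show ?thesis
    using assms by (simp add: power_mult_distrib exp_of_nat_mult[symmetric] power_divide)
qed

section \<open>The likelihood and its maximizers\<close>

lemma alpha_pos: "0 < p \<Longrightarrow> p < 1 \<Longrightarrow> 0 < alpha p"
  by (simp add: alpha_def)

lemma likelihood_eq:
  assumes "0 < alpha p"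
  shows "likelihood p N s m l
    = (alpha p / ((alpha p)\<^sup>2 + 1)) ^ N * (l ^ N * exp (- (l * risk (alpha p) (inverse (alpha p)) N s m)))"
proof -
  \<comment> \<open>In both branches of the density the exponent is \<open>- l\<close> times the
    loss.\<close>
  have "al_density p m l x
      = alpha p / ((alpha p)\<^sup>2 + 1) * l * exp (- (l * pinball (alpha p) (inverse (alpha p)) (x - m)))" for x
    using assms by (simp add: al_density_def beta_def pinball_of_nonneg pinball_of_nonpos mult_ac)
  then have "likelihood p N s m l = (\<Prod>i=1..N. alpha p / ((alpha p)\<^sup>2 + 1) * l
      * exp (- (l * pinball (alpha p) (inverse (alpha p)) (s i - m))))"
    by (simp add: likelihood_def)
  also have "\<dots> = (alpha p / ((alpha p)\<^sup>2 + 1) * l) ^ N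
      * exp (\<Sum>i=1..N. - (l * pinball (alpha p) (inverse (alpha p)) (s i - m)))"
    by (simp add: prod.distrib exp_sum del: times_divide_eq_left)
  finally show ?thesis
    by (simp add: risk_def sum_negf sum_distrib_left power_mult_distrib power_divide)
qed

text \<open>Samples equal to \<open>m\<close> have zero loss, so the strict sets carry the whole
  risk. If the risk is 0, both sides are 0 by the convention for division.\<close>

lemma lambda_star_eq:
  assumes "0 < alpha p"
  shows "lambda_star p N s m = N / risk (alpha p) (inverse (alpha p)) N s m"
proof -
  let ?a = "alpha p" and ?b = "inverse (alpha p)"
  have "risk ?a ?b N s m = (\<Sum>i=1..N. (if s i > m then ?a * (s i - m) else 0)
      - (if s i < m then ?b * (s i - m) else 0))"
    unfolding risk_def using assms
    by (intro sum.cong refl) (auto simp: pinball_of_nonneg pinball_of_nonpos not_less)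
  also have "\<dots> = ?a * (\<Sum>i\<in>S_plus N s m. s i - m) - ?b * (\<Sum>i\<in>S_minus N s m. s i - m)"
    unfolding S_plus_def S_minus_def
    by (simp only: sum.inter_filter[symmetric] finite_atLeastAtMost sum_subtractf
        sum_distrib_left right_diff_distrib)
  finally show ?thesis by (simp add: lambda_star_def)
qed

lemma is_optimum_iff:
  "is_optimum p N s m l
   \<longleftrightarrow> 0 < l \<and> (\<forall>m' l'. 0 < l' \<longrightarrow> likelihood p N s m' l' \<le> likelihood p N s m l)"
  unfolding is_optimum_def is_arg_max_def by (auto simp: not_less) (meson not_le)+

text \<open>The competitor \<open>m'\<close> is compared at the same \<open>l\<close>, so the
  positive factors cancel and only the exponents remain.\<close>

lemma optimal_partition_minimizes_risk:
  assumes a: "0 < alpha p" and opt: "optimal_partition p N s m"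
  shows "risk (alpha p) (inverse (alpha p)) N s m \<le> risk (alpha p) (inverse (alpha p)) N s m'"
proof -
  obtain l where l: "0 < l" "likelihood p N s m' l \<le> likelihood p N s m l"
    using opt by (auto simp: optimal_partition_def is_optimum_iff)
  moreover have "0 < (alpha p)\<^sup>2 + 1" by (simp add: add_nonneg_pos)
  ultimately show ?thesis
    using a by (simp add: likelihood_eq zero_less_power)
qed

lemma weighted_median_is_optimum:
  assumes a: "0 < alpha p" and ij: "i \<in> {1..N}" "j \<in> {1..N}" "s i \<noteq> s j"
    and med: "is_weighted_median (inverse (alpha p)) (alpha p) N s m"
  shows "is_optimum p N s m (lambda_star p N s m)"
proof -
  let ?R = "risk (alpha p) (inverse (alpha p)) N s"
  have R: "0 < ?R m" using risk_pos a ij by simp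
  have N: "0 < N" using ij by auto
  have "likelihood p N s m' l \<le> likelihood p N s m (N / ?R m)" if "0 < l" for m' l
  proof -
    \<comment> \<open>First \<open>m'\<close> is improved to \<open>m\<close> at fixed
      \<open>l\<close>, then \<open>l\<close> is optimized at fixed \<open>m\<close>.\<close>
    have "l ^ N * exp (- (l * ?R m')) \<le> l ^ N * exp (- (l * ?R m))"
      using weighted_median_minimizes_risk[OF _ _ med] a that by (intro mult_left_mono) auto
    also have "\<dots> \<le> (N / ?R m) ^ N * exp (- real N)"
      using power_mult_exp_le_at_ratio that R N by simp
    finally show ?thesis
      using a R unfolding likelihood_eq[OF a] by (intro mult_left_mono) auto
  qed
  then show ?thesis using R N a by (simp add: is_optimum_iff lambda_star_eq)
qed

text \<open>If \<open>N > 0\<close> and all samples coincide, the risk vanishes at their common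
  value and the likelihood there is unbounded in \<open>l\<close>; hence the demand for two distinct
  values. The set equalities remove boundary samples because a sample equal to \<open>m1\<close> is
  left of \<open>m2\<close> but not of \<open>m1\<close>, and symmetrically for
  \<open>m2\<close>.\<close>

theorem theorem8:
  fixes p :: real and N :: nat and s :: "nat \<Rightarrow> real"
  assumes "0 < p" and "p < 1"
  shows
    "(\<exists>m. is_weighted_median (inverse (alpha p)) (alpha p) N s m) \<and>
     ((\<exists>i\<in>{1..N}. \<exists>j\<in>{1..N}. s i \<noteq> s j) \<longrightarrow>
       (\<forall>m. is_weighted_median (inverse (alpha p)) (alpha p) N s m \<longrightarrow>
            is_optimum p N s m (lambda_star p N s m))) \<and>
     (\<forall>m1 m2. optimal_partition p N s m1 \<and> optimal_partition p N s m2 \<and> m1 < m2 \<longrightarrow>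
        \<not> (\<exists>i\<in>{1..N}. m1 < s i \<and> s i < m2) \<and>
        S_minus N s m1 = S_minus N s m2 - {i. s i = m1} \<and>
        S_plus N s m2 = S_plus N s m1 - {i. s i = m2})"
proof -
  have a: "0 < alpha p" using assms by (rule alpha_pos)
  have gap: "\<not> (\<exists>i\<in>{1..N}. m1 < s i \<and> s i < m2)"
    if "optimal_partition p N s m1" "optimal_partition p N s m2" for m1 m2
    using no_sample_between_minimizers[OF a, of "inverse (alpha p)" N s m1 m2]
      optimal_partition_minimizes_risk[OF a] that a
    by (metis inverse_positive_iff_positive)
  have same_sides: "S_minus N s m1 = S_minus N s m2 - {i. s i = m1} \<and> S_plus N s m2 = S_plus N s m1 - {i. s i = m2}"
    if "\<not> (\<exists>i\<in>{1..N}. m1 < s i \<and> s i < m2)" "m1 < m2" for m1 m2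
  proof -
    have "s i \<le> m1 \<or> m2 \<le> s i" if "i \<in> {1..N}" for i
      using that \<open>\<not> (\<exists>i\<in>{1..N}. m1 < s i \<and> s i < m2)\<close> by (meson not_le)
    then show ?thesis
      using \<open>m1 < m2\<close> unfolding S_minus_def S_plus_def by fastforce
  qed
  have "0 \<le> inverse (alpha p)" "0 \<le> alpha p" using a by simp_all
  then show ?thesis
    using a gap same_sides
    by (intro conjI allI impI) (blast intro: weighted_median_exists weighted_median_is_optimum)+
qed

end
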